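(* If there is a $c$-competitive deterministic online algorithm for the unit CNN problem, then $c\ge 3$. This holds even when the requests arrive in an orthogonal manner, i.e., each request except the first shares its $x$ or its $y$ coordinate with the previous request.
   Context: Unit CNN problem: a single server lives in $\mathbb{R}^2$ (online and offline servers start at the same position). Requests $r_1,r_2,\dots\in\mathbb{R}^2$ arrive online; after request $r_i$ is revealed, and before $r_{i+1}$ is revealed, the server must move (possibly not at all) to a point that has the same $x$ coordinate or the same $y$ coordinate as $r_i$. Each move that is purely horizontal or purely vertical costs $\$1$ regardless of distance, a move with both a nonzero horizontal and a nonzero vertical component costs $\$2$, and not moving costs nothing. The objective is to minimize total payment. An online algorithm is $c$-competitive if there is a constant $\alpha$ such that on every finite request sequence its total payment is at most $c$ times the optimal offline payment plus $\alpha$. *)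

theory Defs
  imports Complex_Main
begin

type_synonym point = "real \<times> real"

definition move_cost :: "point \<Rightarrow> point \<Rightarrow> nat" where
  "move_cost p q = (if fst p \<noteq> fst q then 1 else 0) + (if snd p \<noteq> snd q then 1 else 0)"

definition serves :: "point \<Rightarrow> point \<Rightarrow> bool" where
  "serves p r \<longleftrightarrow> fst p = fst r \<or> snd p = snd r"

text \<open>A schedule for a request sequence is the list of the server positions after each request;
  the common start position of the online and offline servers is a separate argument.\<close>

definition feasible :: "point list \<Rightarrow> point list \<Rightarrow> bool" where
  "feasible rs ps \<longleftrightarrow> list_all2 serves ps rs"

fun schedule_cost :: "point \<Rightarrow> point list \<Rightarrow> nat" where
  "schedule_cost s [] = 0"
| "schedule_cost s (p # ps) = move_cost s p + schedule_cost p ps"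

text \<open>The infimum is a minimum: the set is a nonempty set of naturals, as \<open>rs\<close> is itself a
  feasible schedule for \<open>rs\<close>.\<close>

definition opt_cost :: "point \<Rightarrow> point list \<Rightarrow> nat" where
  "opt_cost s rs = Inf {schedule_cost s ps | ps. feasible rs ps}"

text \<open>A deterministic online algorithm maps the nonempty list of requests revealed so far to the
  next server position.  Earlier positions and any internal state are determined by that list.\<close>

type_synonym online_alg = "point list \<Rightarrow> point"

definition online_schedule :: "online_alg \<Rightarrow> point list \<Rightarrow> point list" where
  "online_schedule A rs = map (\<lambda>i. A (take (Suc i) rs)) [0..<length rs]"

text \<open>The set \<open>I\<close> consists of the request sequences that may occur; the algorithm need only serve
  the requests of those.\<close>

definition online_algorithm :: "point list set \<Rightarrow> online_alg \<Rightarrow> bool" where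
  "online_algorithm I A \<longleftrightarrow> (\<forall>rs\<in>I. feasible rs (online_schedule A rs))"

definition competitive :: "point list set \<Rightarrow> point \<Rightarrow> real \<Rightarrow> online_alg \<Rightarrow> bool" where
  "competitive I s c A \<longleftrightarrow>
     (\<exists>\<alpha>::real. \<forall>rs\<in>I.
        real (schedule_cost s (online_schedule A rs)) \<le> c * real (opt_cost s rs) + \<alpha>)"

definition orthogonal_sequences :: "point list set" where
  "orthogonal_sequences =
     {rs. \<forall>i. Suc i < length rs \<longrightarrow>
        fst (rs ! Suc i) = fst (rs ! i) \<or> snd (rs ! Suc i) = snd (rs ! i)}"

end

theory Submission
  imports Defs
begin

text \<open>
  Fix a rectangle and request only its vertices, each request being adjacent to the previous one.
  Three offline servers occupy the vertices other than the one opposite to the last request. When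
  the request moves along an edge, two of them serve it, and the third moves to the vertex opposite
  to its former opposite, at cost 1; so together they pay 1 per request, up to a constant.
  The online server stands on the row or the column of the last request. If it is on the column,
  request the horizontal neighbour, otherwise the vertical one. Unless it stands on the request
  point itself, it must pay at least 1. It gets a free step only from the request point, but getting
  there cost it 2, which is accounted for by a potential of 1. Hence it pays 1 per request, while
  the cheapest of the three offline servers pays at most a third of that.
\<close>

text \<open>The final position is recorded so that a schedule can be prolonged by one request.
  Prefixing \<open>s\<close> to \<open>ps\<close> covers the empty schedule.\<close>

definition reachable :: "point \<Rightarrow> point list \<Rightarrow> point \<Rightarrow> nat \<Rightarrow> bool" where
  "reachable s rs p k \<longleftrightarrow>
     (\<exists>ps. feasible rs ps \<and> schedule_cost s ps = k \<and> last (s # ps) = p)"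

lemma schedule_cost_snoc:
  "schedule_cost s (ps @ [p]) = schedule_cost s ps + move_cost (last (s # ps)) p"
  by (induction ps arbitrary: s) auto

lemma feasible_snoc: "feasible (rs @ [r]) (ps @ [p]) \<longleftrightarrow> feasible rs ps \<and> serves p r"
  using list_all2_rev[of serves "ps @ [p]" "rs @ [r]"] by (auto simp: feasible_def)

lemma reachable_Nil: "reachable s [] s 0"
  by (simp add: reachable_def feasible_def)

lemma reachable_snoc:
  assumes "reachable s rs p k" "serves q r"
  shows "reachable s (rs @ [r]) q (k + move_cost p q)"
proof -
  obtain ps where "feasible rs ps" "schedule_cost s ps = k" "last (s # ps) = p"
    using assms(1) unfolding reachable_def by blast
  then show ?thesis
    unfolding reachable_def using assms(2)
    by (intro exI[of _ "ps @ [q]"]) (simp add: feasible_snoc schedule_cost_snoc)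
qed

lemma reachable_snoc_stay:
  "reachable s rs p k \<Longrightarrow> serves p r \<Longrightarrow> reachable s (rs @ [r]) p k"
  using reachable_snoc[of s rs p k p r] by (simp add: move_cost_def)

lemma opt_cost_le: "reachable s rs p k \<Longrightarrow> opt_cost s rs \<le> k"
  unfolding opt_cost_def reachable_def by (rule cInf_lower) auto

lemma online_schedule_snoc:
  "online_schedule A (rs @ [r]) = online_schedule A rs @ [A (rs @ [r])]"
  by (simp add: online_schedule_def)

lemma online_cost_snoc:
  assumes "rs \<noteq> []"
  shows "schedule_cost s (online_schedule A (rs @ [r])) =
    schedule_cost s (online_schedule A rs) + move_cost (A rs) (A (rs @ [r]))"
proof -
  \<comment> \<open>With no requests the server is still at \<open>s\<close>, which need not be
    \<open>A []\<close>; hence \<open>rs\<close> is nonempty.\<close>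
  have "last (s # online_schedule A rs) = A rs"
    using assms by (cases rs rule: rev_cases) (simp_all add: online_schedule_snoc)
  then show ?thesis
    by (simp only: online_schedule_snoc schedule_cost_snoc)
qed

lemma online_algorithm_serves:
  assumes "online_algorithm I A" "rs @ [r] \<in> I"
  shows "serves (A (rs @ [r])) r"
  using assms by (fastforce simp: online_algorithm_def online_schedule_snoc feasible_snoc)

lemma orthogonal_sequences_singleton: "[r] \<in> orthogonal_sequences"
  by (simp add: orthogonal_sequences_def)

lemma orthogonal_sequences_snoc:
  assumes "rs \<in> orthogonal_sequences" "rs \<noteq> []" "serves r (last rs)"
  shows "rs @ [r] \<in> orthogonal_sequences"
proof -
  have "fst ((rs @ [r]) ! Suc i) = fst ((rs @ [r]) ! i) \<or>
        snd ((rs @ [r]) ! Suc i) = snd ((rs @ [r]) ! i)" if "Suc i < length (rs @ [r])" for i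
  proof (cases "Suc i < length rs")
    case True
    then show ?thesis
      using assms(1) by (simp add: orthogonal_sequences_def nth_append)
  next
    case False
    then have "i = length rs - 1" "Suc i = length rs"
      using that by auto
    then show ?thesis
      using assms(2,3) by (auto simp: nth_append last_conv_nth serves_def)
  qed
  then show ?thesis
    by (simp add: orthogonal_sequences_def)
qed

text \<open>Here \<open>(a, b)\<close> is meant as the last request and \<open>(a', b')\<close> as
  the vertex left free. The first request costs each server at most 2, and 6 = 1 + 5 gives the
  constant.\<close>

definition offline_triple ::
  "point \<Rightarrow> point list \<Rightarrow> real \<Rightarrow> real \<Rightarrow> real \<Rightarrow> real \<Rightarrow> bool" where
  "offline_triple s rs a b a' b' \<longleftrightarrow>
     (\<exists>i j k. reachable s rs (a, b) i \<and> reachable s rs (a', b) j \<and> reachable s rs (a, b') k \<and>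
        i + j + k \<le> length rs + 5)"

lemma offline_triple_start: "offline_triple s [(a, b)] a b a' b'"
proof -
  have "move_cost s p \<le> 2" for p
    by (simp add: move_cost_def)
  from this[of "(a, b)"] this[of "(a', b)"] this[of "(a, b')"]
  have "move_cost s (a, b) + move_cost s (a', b) + move_cost s (a, b') \<le> length [(a, b)] + 5"
    by simp
  moreover have "reachable s [(a, b)] p (move_cost s p)" if "serves p (a, b)" for p
    using reachable_snoc[OF reachable_Nil that] by simp
  ultimately show ?thesis
    unfolding offline_triple_def serves_def by (metis fst_conv snd_conv)
qed

text \<open>Two servers already stand on row \<open>b\<close>; the third moves from
  \<open>(a, b')\<close> to \<open>(a', b')\<close>. The free vertex is then \<open>(a, b')\<close>,
  so \<open>a\<close> and \<open>a'\<close> swap roles.\<close>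

lemma offline_triple_horizontal:
  assumes "offline_triple s rs a b a' b'" "a \<noteq> a'"
  shows "offline_triple s (rs @ [(a', b)]) a' b a b'"
proof -
  obtain i j k where reach: "reachable s rs (a, b) i" "reachable s rs (a', b) j"
    "reachable s rs (a, b') k" and le: "i + j + k \<le> length rs + 5"
    using assms(1) unfolding offline_triple_def by blast
  have "reachable s (rs @ [(a', b)]) (a', b') (k + 1)"
    using reachable_snoc[OF reach(3), of "(a', b')" "(a', b)"] assms(2)
    by (simp add: serves_def move_cost_def)
  moreover have "reachable s (rs @ [(a', b)]) (a, b) i" "reachable s (rs @ [(a', b)]) (a', b) j"
    using reach by (auto intro!: reachable_snoc_stay simp: serves_def)
  ultimately show ?thesis
    unfolding offline_triple_def using le
    by (intro exI[of _ j] exI[of _ i] exI[of _ "k + 1"]) simp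
qed

lemma offline_triple_vertical:
  assumes "offline_triple s rs a b a' b'" "b \<noteq> b'"
  shows "offline_triple s (rs @ [(a, b')]) a b' a' b"
proof -
  obtain i j k where reach: "reachable s rs (a, b) i" "reachable s rs (a', b) j"
    "reachable s rs (a, b') k" and le: "i + j + k \<le> length rs + 5"
    using assms(1) unfolding offline_triple_def by blast
  have "reachable s (rs @ [(a, b')]) (a', b') (j + 1)"
    using reachable_snoc[OF reach(2), of "(a', b')" "(a, b')"] assms(2)
    by (simp add: serves_def move_cost_def)
  moreover have "reachable s (rs @ [(a, b')]) (a, b) i" "reachable s (rs @ [(a, b')]) (a, b') k"
    using reach by (auto intro!: reachable_snoc_stay simp: serves_def)
  ultimately show ?thesis
    unfolding offline_triple_def using le
    by (intro exI[of _ k] exI[of _ "j + 1"] exI[of _ i]) simp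
qed

text \<open>The optimum is at most each of the three costs, hence at most their average.\<close>

lemma three_opt_cost_le:
  "offline_triple s rs a b a' b' \<Longrightarrow> 3 * opt_cost s rs \<le> length rs + 5"
  unfolding offline_triple_def by (force dest!: opt_cost_le)

definition potential :: "online_alg \<Rightarrow> point list \<Rightarrow> nat" where
  "potential A rs = (if A rs = last rs then 1 else 0)"

lemma adversary_sequence:
  assumes A: "online_algorithm orthogonal_sequences A"
  shows "\<exists>rs a b a' b'. rs \<in> orthogonal_sequences \<and> length rs = Suc n \<and> last rs = (a, b) \<and>
    a \<noteq> a' \<and> b \<noteq> b' \<and> offline_triple s rs a b a' b' \<and>
    length rs + potential A rs \<le> schedule_cost s (online_schedule A rs) + 2"
proof (induction n)
  case 0
  \<comment> \<open>Any nondegenerate rectangle works, wherever \<open>s\<close> lies. The slack 2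
    in the cost bound covers length 1 plus potential at most 1.\<close>
  have "offline_triple s [(0, 0)] 0 0 1 1"
    by (rule offline_triple_start)
  then show ?case
    by (intro exI[of _ "[(0, 0)]"] exI[of _ 0] exI[of _ 1])
      (auto simp: orthogonal_sequences_singleton potential_def)
next
  case (Suc n)
  then obtain rs a b a' b' where orth: "rs \<in> orthogonal_sequences" and len: "length rs = Suc n"
    and last: "last rs = (a, b)" and ne: "a \<noteq> a'" "b \<noteq> b'"
    and triple: "offline_triple s rs a b a' b'"
    and cost: "length rs + potential A rs \<le> schedule_cost s (online_schedule A rs) + 2"
    by blast
  have nonempty: "rs \<noteq> []"
    using len by auto
  have served: "serves (A rs) (a, b)"
    using online_algorithm_serves[OF A, of "butlast rs" "last rs"] orth nonempty
    by (simp flip: last)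
  have extend: "rs @ [r] \<in> orthogonal_sequences" "serves (A (rs @ [r])) r" if "serves r (a, b)" for r
    using orthogonal_sequences_snoc[OF orth nonempty] online_algorithm_serves[OF A] that last by auto
  \<comment> \<open>Amortized step: payment plus released potential must be at least 1.\<close>
  have new_cost: "length (rs @ [r]) + potential A (rs @ [r])
      \<le> schedule_cost s (online_schedule A (rs @ [r])) + 2"
    if "1 + potential A (rs @ [r]) \<le> move_cost (A rs) (A (rs @ [r])) + potential A rs" for r
    using that cost online_cost_snoc[OF nonempty, of s A r] by simp
  show ?case
  proof (cases "fst (A rs) = a")
    case True
    let ?r = "(a', b)"
    have "serves ?r (a, b)"
      by (simp add: serves_def)
    note ext = extend[OF this]
    \<comment> \<open>From \<open>(a, b)\<close> the old potential pays for staying on row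
      \<open>b\<close>, and reaching \<open>?r\<close> costs 1 more. From elsewhere on the column,
      serving costs at least 1 and reaching \<open>?r\<close> costs 2.\<close>
    have "1 + potential A (rs @ [?r]) \<le> move_cost (A rs) (A (rs @ [?r])) + potential A rs"
      using True ext(2) ne last
      by (auto simp: potential_def move_cost_def serves_def prod_eq_iff)
    from new_cost[OF this] show ?thesis
      using ext(1) offline_triple_horizontal[OF triple ne(1)] ne len
      by (intro exI[of _ "rs @ [?r]"] exI[of _ a'] exI[of _ b] exI[of _ a] exI[of _ b']) auto
  next
    case False
    then have row: "snd (A rs) = b"
      using served by (simp add: serves_def)
    let ?r = "(a, b')"
    have "serves ?r (a, b)"
      by (simp add: serves_def)
    note ext = extend[OF this]
    \<comment> \<open>The server is off column \<open>a\<close>, so the old potential is 0; serving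
      costs at least 1 and reaching \<open>?r\<close> costs 2.\<close>
    have "1 + potential A (rs @ [?r]) \<le> move_cost (A rs) (A (rs @ [?r])) + potential A rs"
      using False row ext(2) ne last
      by (auto simp: potential_def move_cost_def serves_def prod_eq_iff)
    from new_cost[OF this] show ?thesis
      using ext(1) offline_triple_vertical[OF triple ne(2)] ne len
      by (intro exI[of _ "rs @ [?r]"] exI[of _ a] exI[of _ b'] exI[of _ a'] exI[of _ b]) auto
  qed
qed

lemma orthogonal_lower_bound:
  assumes A: "online_algorithm orthogonal_sequences A"
    and "competitive orthogonal_sequences s c A"
  shows "c \<ge> 3"
proof (rule ccontr)
  assume "\<not> c \<ge> 3"
  \<comment> \<open>A nonnegative factor is required to replace the optimum by its upper
    bound.\<close>
  define d where "d = max c 0"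
  have d: "0 \<le> d" "d < 3" "c \<le> d"
    using \<open>\<not> c \<ge> 3\<close> by (auto simp: d_def)
  obtain \<alpha> where \<alpha>: "\<And>rs. rs \<in> orthogonal_sequences \<Longrightarrow>
      real (schedule_cost s (online_schedule A rs)) \<le> c * real (opt_cost s rs) + \<alpha>"
    using assms(2) unfolding competitive_def by blast
  \<comment> \<open>The right side does not depend on \<open>n\<close>, whereas the left side is
    unbounded since \<open>d\<close> is below 3.\<close>
  have bound: "(3 - d) * real n \<le> 5 * d + 3 * \<alpha> + 6" for n
  proof -
    obtain rs where rs: "rs \<in> orthogonal_sequences" "length rs = Suc n"
      "3 * opt_cost s rs \<le> length rs + 5"
      "length rs \<le> schedule_cost s (online_schedule A rs) + 2"
      using adversary_sequence[OF A, of n s] three_opt_cost_le by (metis add_leD1)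
    have "real (Suc n) - 2 \<le> real (schedule_cost s (online_schedule A rs))"
      using rs(2,4) by linarith
    also note \<alpha>[OF rs(1)]
    finally have "3 * (real (Suc n) - 2) \<le> 3 * (c * real (opt_cost s rs) + \<alpha>)"
      by simp
    also have "\<dots> \<le> d * (3 * real (opt_cost s rs)) + 3 * \<alpha>"
      using mult_right_mono[OF d(3), of "real (opt_cost s rs)"] by simp
    also have "\<dots> \<le> d * (real (Suc n) + 5) + 3 * \<alpha>"
      using rs(2,3) d(1) by (intro add_right_mono mult_left_mono) linarith+
    finally have "(3 - d) * real (Suc n) \<le> 5 * d + 3 * \<alpha> + 6"
      by (simp add: algebra_simps)
    moreover have "(3 - d) * real n \<le> (3 - d) * real (Suc n)"
      using d(2) by (intro mult_left_mono) auto
    ultimately show ?thesis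
      by linarith
  qed
  obtain n where "5 * d + 3 * \<alpha> + 6 < real n * (3 - d)"
    using reals_Archimedean3[of "3 - d"] d(2) by auto
  with bound[of n] show False
    by (simp add: mult.commute)
qed

theorem theorem1:
  fixes s :: point and c :: real
  shows "((\<exists>A. online_algorithm UNIV A \<and> competitive UNIV s c A) \<longrightarrow> c \<ge> 3) \<and>
         ((\<exists>A. online_algorithm orthogonal_sequences A \<and>
               competitive orthogonal_sequences s c A) \<longrightarrow> c \<ge> 3)"
proof -
  \<comment> \<open>Fewer admissible sequences only weaken both requirements, so the orthogonal case
    implies the general one.\<close>
  have "online_algorithm orthogonal_sequences A" if "online_algorithm UNIV A" for A
    using that by (simp add: online_algorithm_def)
  moreover have "competitive orthogonal_sequences s c A" if "competitive UNIV s c A" for A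
    using that unfolding competitive_def by blast
  ultimately show ?thesis
    using orthogonal_lower_bound by blast
qed

end
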